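(* Let $G=(V,E)$ be the complete graph on $n\ge5$ nodes. Let $V=V_1\cup\dots\cup V_m$ be a partition of $V$ into $m$ disjoint sets. Let $E_l=\{u_{l1}v_{l1},\dots,u_{lt_l}v_{lt_l}\}$ be the set of edges of the clique on $V_l$, where $t_l=\binom{|V_l|}{2}$, and let $F=E_1\cup\dots\cup E_m$. Let $G'=(V',E')$ be a graph with $n+\sum_{l=1}^m t_l$ nodes, $n$ of which are labelled by $V$, the others being grouped into sets $W_1,\dots,W_m$ with $W_l=\{w_{l1},\dots,w_{lt_l}\}$. Suppose: (i) the subgraph of $G'$ induced by $V$ is the complete $m$-partite graph $\mathrm{K}_{|V_1|,\dots,|V_m|}$ with parts $V_1,\dots,V_m$; (ii) for $l=1,\dots,m$, $W_l$ is an independent set in $G'$; (iii) for $l=1,\dots,m$ and $i=1,\dots,t_l$, $u_{li}w_{li},v_{li}w_{li}\in E'$. Then $G'$ is a triangular elimination of $G$ with respect to $F$ in which node $w_{li}$ is associated with edge $u_{li}v_{li}$, and every triangular elimination of any facet inducing inequality for $\mathrm{CUT}^\square(G)$ which is not a triangle inequality is facet inducing for $\mathrm{CUT}^\square(G')$.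
   Context: For a graph $G=(V,E)$ and $S\subseteq V$, the cut vector $\bm{\delta}_G(S)\in\mathbb{R}^E$ has $uv$-coordinate $1$ if $|S\cap\{u,v\}|=1$ and $0$ otherwise; $\mathrm{CUT}^\square(G)$ is the convex hull of all cut vectors. Facet inducing means valid with the induced face a facet. Coordinates are indexed by unordered pairs, $x_{uv}=x_{vu}$. For nodes $u,v,w$ define the triangular forms $\Delta(u,v;w)=x_{uv}-x_{uw}-x_{vw}$ and $\Delta(u,v,w)=x_{uv}+x_{uw}+x_{vw}-2$; $\Delta\{u,v,w\}$ denotes any one of $\Delta(u,v;w)$, $\Delta(w,v;u)$, $\Delta(u,w;v)$, $\Delta(u,v,w)$. A triangle inequality is one of the form $\lambda\Delta\{u,v,w\}\le0$ with $\lambda>0$ and $u,v,w$ distinct nodes. Given $F=\{u_iv_i\mid i=1,\dots,t\}\subseteq E$, a graph $G'=(V',E')$ is a triangular elimination of $G$ with respect to $F$ if $V'=V\cup\{w_1,\dots,w_t\}$ with $w_i$ distinct nodes not in $V$, $E'\supseteq\{w_iu_i,w_iv_i\}$ for all $i$, and $E'\cap E=E\setminus F$; $w_i$ is associated with $u_iv_i$. Then $(\bm{a}')^{\mathrm{T}}\bm{x}\le a'_0$ ($\bm a'\in\mathbb{R}^{E'}$) is a triangular elimination of $\bm{a}^{\mathrm{T}}\bm{x}\le a_0$ ($\bm a\in\mathbb{R}^E$) if for some choices of triangular forms $\Delta_i\{u_i,v_i,w_i\}$ one has the identity of affine functions $(\bm{a}')^{\mathrm{T}}\bm{x}-a'_0=\bm{a}^{\mathrm{T}}\bm{x}-a_0+\sum_{i=1}^t|a_{u_iv_i}|\,\Delta_i\{u_i,v_i,w_i\}$.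 *)

theory Defs
  imports "HOL-Analysis.Analysis" "HOL-Library.Ramsey"
begin

text \<open>
  A finite simple graph is a pair of a node set \<open>V\<close> and an edge set \<open>E\<close> of two-element subsets
  of \<open>V\<close>. All nodes are drawn from an arbitrary finite type \<open>'v\<close>, so that every \<open>\<real>\<^sup>E\<close> is a
  coordinate subspace of one Euclidean space \<open>real ^ ('v set)\<close>, coordinates being indexed by
  unordered pairs. This gives \<open>E \<union> E'\<close>-variable identities a common domain, and faces, facets
  and affine dimension are those of the library, being insensitive to the ambient space.
\<close>

definition simple_graph :: "'v::finite set \<Rightarrow> 'v set set \<Rightarrow> bool" where
  "simple_graph V E \<longleftrightarrow> E \<subseteq> nsets V 2"

definition multipartite_edges :: "'i set \<Rightarrow> ('i \<Rightarrow> 'v set) \<Rightarrow> 'v set set" where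
  "multipartite_edges I P = {{x, y} | x y k l. k \<in> I \<and> l \<in> I \<and> k \<noteq> l \<and> x \<in> P k \<and> y \<in> P l}"

definition edge_space :: "'v::finite set set \<Rightarrow> (real ^ ('v set)) set" where
  "edge_space E = {x. \<forall>e. e \<notin> E \<longrightarrow> x $ e = 0}"

definition cut_vector :: "'v::finite set set \<Rightarrow> 'v set \<Rightarrow> real ^ ('v set)" where
  "cut_vector E S = (\<chi> e. if e \<in> E \<and> card (S \<inter> e) = 1 then 1 else 0)"

definition cut_polytope :: "'v::finite set \<Rightarrow> 'v set set \<Rightarrow> (real ^ ('v set)) set" where
  "cut_polytope V E = convex hull (cut_vector E ` Pow V)"

text \<open>An inequality \<open>a\<^sup>T x \<le> a0\<close> is given by the pair \<open>a\<close>, \<open>a0\<close>.\<close>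

definition facet_inducing ::
  "'v::finite set \<Rightarrow> 'v set set \<Rightarrow> real ^ ('v set) \<Rightarrow> real \<Rightarrow> bool" where
  "facet_inducing V E a a0 \<longleftrightarrow>
     a \<in> edge_space E \<and>
     (\<forall>x \<in> cut_polytope V E. a \<bullet> x \<le> a0) \<and>
     {x \<in> cut_polytope V E. a \<bullet> x = a0} facet_of cut_polytope V E"

text \<open>\<open>\<Delta>(u,v;w)\<close> and \<open>\<Delta>(u,v,w)\<close>, respectively.\<close>

definition tri_rooted :: "'v::finite \<Rightarrow> 'v \<Rightarrow> 'v \<Rightarrow> real ^ ('v set) \<Rightarrow> real" where
  "tri_rooted u v w x = x $ {u, v} - x $ {u, w} - x $ {v, w}"

definition tri_perimeter :: "'v::finite \<Rightarrow> 'v \<Rightarrow> 'v \<Rightarrow> real ^ ('v set) \<Rightarrow> real" where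
  "tri_perimeter u v w x = x $ {u, v} + x $ {u, w} + x $ {v, w} - 2"

definition triangular_forms :: "'v::finite \<Rightarrow> 'v \<Rightarrow> 'v \<Rightarrow> (real ^ ('v set) \<Rightarrow> real) set" where
  "triangular_forms u v w =
     {tri_rooted u v w, tri_rooted w v u, tri_rooted u w v, tri_perimeter u v w}"

text \<open>The inequality \<open>a\<^sup>T x \<le> a0\<close> is literally \<open>c * \<Delta>{u,v,w} \<le> 0\<close> for some \<open>c > 0\<close>, i.e. both
  have the same affine function \<open>a\<^sup>T x - a0\<close>.\<close>

definition triangle_inequality :: "'v::finite set \<Rightarrow> real ^ ('v set) \<Rightarrow> real \<Rightarrow> bool" where
  "triangle_inequality V a a0 \<longleftrightarrow>
     (\<exists>c u v w \<Delta>. c > 0 \<and> {u, v, w} \<subseteq> V \<and> distinct [u, v, w] \<and>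
        \<Delta> \<in> triangular_forms u v w \<and> (\<forall>x. a \<bullet> x - a0 = c * \<Delta> x))"

text \<open>\<open>w e\<close> is the new node associated with the eliminated edge \<open>e \<in> F\<close>.\<close>

definition graph_triangular_elimination ::
  "'v::finite set \<Rightarrow> 'v set set \<Rightarrow> 'v set set \<Rightarrow> ('v set \<Rightarrow> 'v) \<Rightarrow> 'v set \<Rightarrow> 'v set set \<Rightarrow> bool" where
  "graph_triangular_elimination V E F w V' E' \<longleftrightarrow>
     simple_graph V E \<and> simple_graph V' E' \<and> F \<subseteq> E \<and>
     inj_on w F \<and> w ` F \<inter> V = {} \<and> V' = V \<union> w ` F \<and>
     (\<forall>e \<in> F. \<forall>u \<in> e. {w e, u} \<in> E') \<and>
     E' \<inter> E = E - F"

text \<open>In the following, the graph with edge set \<open>E'\<close> is a triangular elimination of the graph with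
  edge set \<open>E\<close> with respect to \<open>F\<close> and the node association \<open>w\<close>. The identity of affine functions
  includes the coordinates in \<open>F\<close>, on which \<open>a'\<close> vanishes, so it constrains the choice of the
  forms \<open>D e\<close>.\<close>

definition inequality_triangular_elimination ::
  "'v::finite set set \<Rightarrow> 'v set set \<Rightarrow> ('v set \<Rightarrow> 'v) \<Rightarrow> 'v set set \<Rightarrow>
   real ^ ('v set) \<Rightarrow> real \<Rightarrow> real ^ ('v set) \<Rightarrow> real \<Rightarrow> bool" where
  "inequality_triangular_elimination E F w E' a a0 a' a0' \<longleftrightarrow>
     a \<in> edge_space E \<and> a' \<in> edge_space E' \<and>
     (\<exists>D. (\<forall>e \<in> F. \<exists>u v. e = {u, v} \<and> D e \<in> triangular_forms u v (w e)) \<and>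
          (\<forall>x. a' \<bullet> x - a0' = a \<bullet> x - a0 + (\<Sum>e\<in>F. \<bar>a $ e\<bar> * D e x)))"

end

theory Submission
  imports Defs
begin

text \<open>
  Write \<open>s x = \<plusminus>1\<close> for the side of a cut on which \<open>x\<close> lies. On cuts every triangular form is
  \<open>- (1 + \<kappa> s u s v) (1 + \<eta> s u s w) / 2\<close> with signs \<open>\<kappa>\<close>, \<open>\<eta>\<close>, so in a root of the eliminated
  inequality the node \<open>w\<close> associated with \<open>uv\<close> may be moved freely as soon as \<open>s u s v = -\<kappa>\<close>.

  For a facet of the cut polytope of a complete graph that is not a triangle inequality, each
  triple of nodes is cut in all four ways by the roots. Consequently a linear relation
  \<open>\<Sum>z. c z * s z = 0\<close> that holds on all roots with \<open>s u s v = t\<close> is a multiple of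
  \<open>s u - t s v = 0\<close>; in particular, the states of two disjoint edges are independent.
  Let \<open>b\<^sup>T x = b0\<close> hold on all roots of the eliminated inequality. Moving two free new nodes
  shows that \<open>b\<close> vanishes on the edges between new nodes; moving one free node gives a relation of
  the above kind, so that \<open>b\<close> agrees around \<open>w\<close> with a multiple of the triangular form. Subtracting
  these multiples leaves an equation on the complete graph that holds on all roots of the original
  facet, hence is proportional to it.
\<close>

section \<open>Cuts, node signs and the cut polytope\<close>

abbreviation cut :: "'v::finite set \<Rightarrow> real ^ ('v set)" where
  "cut \<equiv> cut_vector UNIV"

text \<open>With signs, a cut coordinate is affine in \<open>side S x * side S y\<close>, and moving
  a node across the cut negates one sign.\<close>

definition side :: "'v set \<Rightarrow> 'v \<Rightarrow> real" where
  "side S x = (if x \<in> S then -1 else 1)"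

lemma side_mult_self [simp]: "side S x * side S x = 1"
  by (simp add: side_def)

lemma cut_pair: "x \<noteq> y \<Longrightarrow> cut S $ {x, y} = (1 - side S x * side S y) / 2"
  by (auto simp: cut_vector_def side_def Int_insert_right)

lemma subspace_edge_space: "subspace (edge_space E)"
  by (auto simp: subspace_def edge_space_def)

lemma axis_in_edge_space: "e \<in> E \<Longrightarrow> axis e r \<in> edge_space E"
  by (auto simp: edge_space_def axis_def)

text \<open>Coefficients off \<open>E\<close> vanish, so the one vector \<open>cut S\<close> over
  all coordinates serves both graphs.\<close>

lemma inner_cut_vector:
  assumes "a \<in> edge_space E"
  shows "a \<bullet> cut_vector E S = a \<bullet> cut S"
  unfolding inner_vec_def
  using assms by (intro sum.cong) (auto simp: edge_space_def cut_vector_def)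

lemma inner_cut_Int:
  assumes "a \<in> edge_space E" "E \<subseteq> Pow V"
  shows "a \<bullet> cut (S \<inter> V) = a \<bullet> cut S"
proof -
  have "a $ e * cut (S \<inter> V) $ e = a $ e * cut S $ e" for e
  proof (cases "e \<in> E")
    case True
    then have "S \<inter> V \<inter> e = S \<inter> e"
      using assms(2) by blast
    then show ?thesis
      by (simp add: cut_vector_def)
  next
    case False
    then show ?thesis
      using assms(1) by (simp add: edge_space_def)
  qed
  then show ?thesis
    unfolding inner_vec_def inner_real_def by (intro sum.cong) auto
qed

lemma nsets_2_subset_Pow: "nsets V 2 \<subseteq> Pow V"
  by (auto simp: nsets_def)

lemma cut_vector_in_cut_polytope: "S \<subseteq> V \<Longrightarrow> cut_vector E S \<in> cut_polytope V E"
  unfolding cut_polytope_def by (auto intro: hull_inc)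

lemma polytope_cut_polytope: "polytope (cut_polytope V E)"
  unfolding cut_polytope_def by (simp add: polytope_convex_hull)

lemma convex_cut_polytope: "convex (cut_polytope V E)"
  unfolding cut_polytope_def by simp

lemma cut_polytope_subset_iff:
  assumes "convex C"
  shows "cut_polytope V E \<subseteq> C \<longleftrightarrow> (\<forall>S \<subseteq> V. cut_vector E S \<in> C)"
  unfolding cut_polytope_def using assms by (auto simp: subset_hull image_subset_iff)

lemma cut_polytope_le_iff:
  assumes "a \<in> edge_space E"
  shows "(\<forall>x \<in> cut_polytope V E. a \<bullet> x \<le> a0) \<longleftrightarrow> (\<forall>S \<subseteq> V. a \<bullet> cut S \<le> a0)"
  using cut_polytope_subset_iff[OF convex_halfspace_le, of V E a a0] assms
  by (auto simp: inner_cut_vector subset_iff)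

lemma cut_polytope_eq_iff:
  assumes "a \<in> edge_space E"
  shows "(\<forall>x \<in> cut_polytope V E. a \<bullet> x = a0) \<longleftrightarrow> (\<forall>S \<subseteq> V. a \<bullet> cut S = a0)"
  using cut_polytope_subset_iff[OF convex_hyperplane, of V E a a0] assms
  by (auto simp: inner_cut_vector subset_iff)

section \<open>Facets and their roots, the cuts attaining equality\<close>

lemma facet_inducing_le:
  assumes "facet_inducing V E a a0" "S \<subseteq> V"
  shows "a \<bullet> cut S \<le> a0"
  using assms cut_polytope_le_iff[of a E V a0] by (auto simp: facet_inducing_def)

lemma facet_inducing_strict:
  assumes "facet_inducing V E a a0"
  obtains S where "S \<subseteq> V" "a \<bullet> cut S < a0"
proof -
  have "\<exists>S \<subseteq> V. a \<bullet> cut S < a0"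
  proof (rule ccontr)
    assume "\<not> ?thesis"
    then have "\<forall>S \<subseteq> V. a \<bullet> cut S = a0"
      using facet_inducing_le[OF assms] by (meson linorder_not_less order_antisym)
    then have "{x \<in> cut_polytope V E. a \<bullet> x = a0} = cut_polytope V E"
      using cut_polytope_eq_iff[of a E V a0] assms by (auto simp: facet_inducing_def)
    then show False
      using assms by (simp add: facet_inducing_def)
  qed
  then show ?thesis
    using that by blast
qed

text \<open>A face of the hull of finitely many points is the hull of some of these points.\<close>

lemma facet_inducing_face:
  assumes "facet_inducing V E a a0"
  obtains R where "R \<subseteq> {S. S \<subseteq> V \<and> a \<bullet> cut S = a0}"
    "{x \<in> cut_polytope V E. a \<bullet> x = a0} = convex hull (cut_vector E ` R)"
proof -
  let ?F = "{x \<in> cut_polytope V E. a \<bullet> x = a0}"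
  have a: "a \<in> edge_space E" and "?F face_of convex hull (cut_vector E ` Pow V)"
    using assms by (auto simp: facet_inducing_def facet_of_def cut_polytope_def)
  then obtain X where X: "X \<subseteq> cut_vector E ` Pow V" and F: "?F = convex hull X"
    by (meson face_of_convex_hull_subset finite_imp_compact finite_code finite_imageI)
  then obtain R where R: "R \<subseteq> Pow V" "X = cut_vector E ` R"
    by (meson subset_image_iff)
  have "a \<bullet> cut S = a0" if "S \<in> R" for S
  proof -
    have "cut_vector E S \<in> ?F"
      unfolding F R using that by (auto intro: hull_inc)
    then show ?thesis
      using a by (simp add: inner_cut_vector)
  qed
  then show ?thesis
    using that[of R] R F by blast
qed

lemma facet_inducing_root:
  assumes "facet_inducing V E a a0"
  obtains S where "S \<subseteq> V" "a \<bullet> cut S = a0"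
proof -
  obtain R where R: "R \<subseteq> {S. S \<subseteq> V \<and> a \<bullet> cut S = a0}"
    "{x \<in> cut_polytope V E. a \<bullet> x = a0} = convex hull (cut_vector E ` R)"
    using facet_inducing_face[OF assms] .
  moreover have "{x \<in> cut_polytope V E. a \<bullet> x = a0} \<noteq> {}"
    using assms by (auto simp: facet_inducing_def facet_of_def)
  ultimately have "R \<noteq> {}"
    by auto
  then show ?thesis
    using that R(1) by blast
qed

text \<open>Full-dimensionality of the cut polytope of the complete graph in dual form: the empty
  cut fixes the constant, and three small cuts isolate each coordinate.\<close>

lemma eq_zero_if_cut_constant:
  assumes c: "c \<in> edge_space (nsets V 2)" and const: "\<And>S. S \<subseteq> V \<Longrightarrow> c \<bullet> cut S = c0"
  shows "c = 0 \<and> c0 = 0"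
proof -
  have c0: "c0 = 0"
  proof -
    have "cut ({} :: 'a set) = 0"
      by (simp add: cut_vector_def vec_eq_iff)
    then show ?thesis
      using const[of "{}"] by simp
  qed
  have "c $ e = 0" for e
  proof (cases "e \<in> nsets V 2")
    case True
    then obtain u v where e: "e = {u, v}" and uv: "u \<in> V" "v \<in> V" "u \<noteq> v"
      by (rule nsets2_E)
    let ?d = "cut {u} + cut {v} - cut {u, v}"
    have "c $ h * ?d $ h = (if h = e then 2 * c $ e else 0)" for h
    proof (cases "h \<in> nsets V 2")
      case True
      then obtain x y where h: "h = {x, y}" "x \<noteq> y"
        by (auto elim: nsets2_E)
      \<comment> \<open>A pair contributes only if cut by both \<open>{u}\<close> and
        \<open>{v}\<close>, which singles out \<open>{u, v}\<close>.\<close>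
      have "?d $ h = (1 - side {u} x * side {u} y) * (1 - side {v} x * side {v} y) / 2"
        using uv(3) h by (simp add: cut_pair) (simp add: side_def)
      also have "\<dots> = (if h = e then 2 else 0)"
        using uv(3) h(2) unfolding h e by (auto simp: side_def doubleton_eq_iff)
      finally show ?thesis
        by simp
    next
      case False
      then show ?thesis
        using c \<open>e \<in> _\<close> by (auto simp: edge_space_def)
    qed
    then have "c \<bullet> ?d = 2 * c $ e"
      by (simp add: inner_vec_def)
    moreover have "c \<bullet> ?d = 0"
      using const[of "{u}"] const[of "{v}"] const[of "{u, v}"] uv c0
      by (simp add: inner_add_right inner_diff_right)
    ultimately show ?thesis
      by simp
  qed (use c in \<open>simp add: edge_space_def\<close>)
  then show ?thesis
    using c0 by (simp add: vec_eq_iff)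
qed

text \<open>The facet and one cut off it affinely span the polytope. An equation valid on all roots,
  corrected by a multiple of the facet equation to hold at that cut too, holds at every cut and is
  trivial.\<close>

lemma facet_inducing_unique:
  assumes f: "facet_inducing V (nsets V 2) a a0" and c: "c \<in> edge_space (nsets V 2)"
    and van: "\<And>S. S \<subseteq> V \<Longrightarrow> a \<bullet> cut S = a0 \<Longrightarrow> c \<bullet> cut S = c0"
  obtains \<mu> where "c = \<mu> *\<^sub>R a" "c0 = \<mu> * a0"
proof -
  let ?E = "nsets V 2" and ?P = "cut_polytope V (nsets V 2)"
  let ?F = "{x \<in> ?P. a \<bullet> x = a0}"
  have a: "a \<in> edge_space ?E" and facet: "?F facet_of ?P"
    using f by (auto simp: facet_inducing_def)
  obtain T where T: "T \<subseteq> V" "a \<bullet> cut T < a0"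
    using facet_inducing_strict[OF f] .
  define t where "t = cut_vector ?E T"
  \<comment> \<open>\<open>\<mu>\<close> is chosen so that the corrected equation holds at the
    non-root \<open>T\<close>.\<close>
  define \<mu> where "\<mu> = (c \<bullet> cut T - c0) / (a \<bullet> cut T - a0)"
  define d d0 where "d = c - \<mu> *\<^sub>R a" and "d0 = c0 - \<mu> * a0"
  have d: "d \<in> edge_space ?E"
    unfolding d_def using a c subspace_edge_space by (meson subspace_diff subspace_scale)
  have dt: "d \<bullet> t = d0"
  proof -
    have "\<mu> * (a \<bullet> cut T - a0) = c \<bullet> cut T - c0"
      using T(2) by (simp add: \<mu>_def)
    then show ?thesis
      unfolding t_def inner_cut_vector[OF d]
      by (simp add: d_def d0_def inner_diff_left algebra_simps)
  qed
  obtain R where R: "R \<subseteq> {S. S \<subseteq> V \<and> a \<bullet> cut S = a0}" "?F = convex hull (cut_vector ?E ` R)"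
    using facet_inducing_face[OF f] .
  have dF: "?F \<subseteq> {x. d \<bullet> x = d0}"
  proof -
    have "cut_vector ?E ` R \<subseteq> {x. d \<bullet> x = d0}"
    proof clarify
      fix S assume "S \<in> R"
      then have "a \<bullet> cut S = a0" "c \<bullet> cut S = c0"
        using R(1) van by auto
      then show "d \<bullet> cut_vector ?E S = d0"
        unfolding inner_cut_vector[OF d] by (simp add: d_def d0_def inner_diff_left)
    qed
    then show ?thesis
      unfolding R(2) by (rule hull_minimal) (rule convex_hyperplane)
  qed
  have "t \<notin> affine hull ?F"
  proof
    assume "t \<in> affine hull ?F"
    moreover have "affine hull ?F \<subseteq> {x. a \<bullet> x = a0}"
      by (rule hull_minimal) (auto simp: affine_hyperplane)
    ultimately show False
      using T(2) a by (auto simp: t_def inner_cut_vector)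
  qed
  then have "aff_dim (insert t ?F) = aff_dim ?P"
    using facet by (simp add: aff_dim_insert facet_of_def)
  moreover have sub: "insert t ?F \<subseteq> ?P"
    using T by (auto simp: t_def cut_vector_in_cut_polytope)
  ultimately have "affine hull (insert t ?F) = affine hull ?P"
    by (simp add: aff_dim_eq_full_gen)
  moreover have "affine hull (insert t ?F) \<subseteq> {x. d \<bullet> x = d0}"
    using dF dt by (intro hull_minimal) (auto simp: affine_hyperplane)
  ultimately have "?P \<subseteq> {x. d \<bullet> x = d0}"
    using hull_subset by (metis order_trans)
  then have "\<forall>S \<subseteq> V. d \<bullet> cut S = d0"
    using cut_polytope_eq_iff[OF d, of V d0] by blast
  then have "d = 0 \<and> d0 = 0"
    using eq_zero_if_cut_constant[OF d] by blast
  then show ?thesis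
    using that[of \<mu>] by (simp add: d_def d0_def)
qed

text \<open>Some facet contains the nonempty proper face of \<open>a\<close>; by
  \<open>unique\<close> its equation is a multiple of that of \<open>a\<close>, so both faces
  coincide.\<close>

lemma facet_inducingI:
  fixes a :: "real ^ ('v::finite set)"
  assumes a: "a \<in> edge_space E" and le: "\<And>S. S \<subseteq> V \<Longrightarrow> a \<bullet> cut S \<le> a0"
    and strict: "T \<subseteq> V" "a \<bullet> cut T < a0" and root: "U \<subseteq> V" "a \<bullet> cut U = a0"
    and unique: "\<And>b b0. b \<in> edge_space E \<Longrightarrow>
        (\<And>S. S \<subseteq> V \<Longrightarrow> a \<bullet> cut S = a0 \<Longrightarrow> b \<bullet> cut S = b0) \<Longrightarrow> \<exists>\<mu>. b = \<mu> *\<^sub>R a \<and> b0 = \<mu> * a0"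
  shows "facet_inducing V E a a0"
proof -
  let ?P = "cut_polytope V E"
  let ?F = "{x \<in> ?P. a \<bullet> x = a0}"
  have valid: "\<forall>x \<in> ?P. a \<bullet> x \<le> a0"
    using le by (simp add: cut_polytope_le_iff[OF a])
  have poly: "polyhedron ?P"
    by (simp add: polytope_imp_polyhedron polytope_cut_polytope)
  have face: "?F face_of ?P"
    using face_of_Int_supporting_hyperplane_le[OF convex_cut_polytope, of V E a a0] valid
    by (simp add: Int_def)
  have "cut_vector E U \<in> ?F" "cut_vector E T \<in> ?P - ?F"
    using root strict a by (auto simp: inner_cut_vector cut_vector_in_cut_polytope)
  then have "?F \<noteq> {}" "?F \<noteq> ?P"
    by blast+
  then obtain G where G: "G facet_of ?P" "?F \<subseteq> G"
    using face_of_polyhedron_subset_facet[OF poly face] by blast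
  obtain b b0 where b: "?P \<subseteq> {x. b \<bullet> x \<le> b0}" "G = ?P \<inter> {x. b \<bullet> x = b0}"
    using facet_of_polyhedron[OF poly G(1)] by metis
  \<comment> \<open>Restricting the ambient equation to \<open>E\<close> keeps its values on cut
    vectors and makes it an argument for \<open>unique\<close>.\<close>
  define c :: "real ^ ('v set)" where "c = (\<chi> e. if e \<in> E then b $ e else 0)"
  have c: "c \<in> edge_space E"
    by (simp add: c_def edge_space_def)
  have cb: "c \<bullet> cut S = b \<bullet> cut_vector E S" for S
    unfolding inner_vec_def by (intro sum.cong) (auto simp: c_def cut_vector_def)
  have "c \<bullet> cut S = b0" if "S \<subseteq> V" "a \<bullet> cut S = a0" for S
  proof -
    have "cut_vector E S \<in> ?F"
      using that a by (auto simp: inner_cut_vector cut_vector_in_cut_polytope)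
    then show ?thesis
      using G(2) b(2) by (auto simp: cb)
  qed
  then obtain \<mu> where \<mu>: "c = \<mu> *\<^sub>R a" "b0 = \<mu> * a0"
    using unique[OF c] by blast
  \<comment> \<open>For \<open>\<mu> = 0\<close> the equation of \<open>G\<close> would hold on the
    whole polytope.\<close>
  have "\<mu> \<noteq> 0"
  proof
    assume "\<mu> = 0"
    then have "\<forall>S \<subseteq> V. b \<bullet> cut_vector E S = b0"
      using \<mu> cb by (metis inner_zero_left mult_zero_left scale_zero_left)
    then have "?P \<subseteq> {x. b \<bullet> x = b0}"
      by (simp add: cut_polytope_subset_iff convex_hyperplane)
    then show False
      using G(1) b(2) by (simp add: Int_absorb2)
  qed
  have "G \<subseteq> ?F"
  proof -
    obtain X where X: "X \<subseteq> cut_vector E ` Pow V" "G = convex hull X"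
      using facet_of_imp_face_of[OF G(1)] unfolding cut_polytope_def
      by (meson face_of_convex_hull_subset finite_imp_compact finite_code finite_imageI)
    have "X \<subseteq> ?F"
    proof
      fix x assume x: "x \<in> X"
      then obtain S where S: "S \<subseteq> V" "x = cut_vector E S"
        using X(1) by blast
      have "x \<in> G"
        using X(2) x by (simp add: hull_inc)
      then have "\<mu> * (a \<bullet> cut S) = \<mu> * a0"
        using b(2) S(2) \<mu> cb[of S] by auto
      then show "x \<in> ?F"
        using \<open>\<mu> \<noteq> 0\<close> S a by (simp add: inner_cut_vector cut_vector_in_cut_polytope)
    qed
    moreover have "convex ?F"
      using face face_of_imp_convex by blast
    ultimately show ?thesis
      unfolding X(2) by (rule hull_minimal)
  qed
  then have "?F facet_of ?P"
    using G by (metis subset_antisym)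
  then show ?thesis
    using a valid by (simp add: facet_inducing_def)
qed

section \<open>Triangular forms with sign parameters\<close>

definition tri_vec :: "real \<Rightarrow> real \<Rightarrow> 'v::finite \<Rightarrow> 'v \<Rightarrow> 'v \<Rightarrow> real ^ ('v set)" where
  "tri_vec \<kappa> \<eta> u v w = axis {u, v} \<kappa> + axis {u, w} \<eta> + axis {v, w} (\<kappa> * \<eta>)"

text \<open>2 for the perimeter signs (1, 1), 0 for the three rooted forms.\<close>

definition tri_const :: "real \<Rightarrow> real \<Rightarrow> real" where
  "tri_const \<kappa> \<eta> = (1 + \<kappa>) * (1 + \<eta>) / 2"

lemma inner_axis_left: "axis i r \<bullet> x = r * x $ i" for x :: "real ^ 'n"
  by (simp add: inner_axis')

text \<open>The signs at \<open>{u, v}\<close> and \<open>{u, w}\<close> determine the form, the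
  third sign being their product, so all four can be treated at once.\<close>

lemma triangular_forms_eq:
  "triangular_forms u v w =
     {\<lambda>x. tri_vec \<kappa> \<eta> u v w \<bullet> x - tri_const \<kappa> \<eta> | \<kappa> \<eta>. \<kappa> \<in> {1, -1} \<and> \<eta> \<in> {1, -1}}"
proof -
  have "{\<lambda>x. tri_vec \<kappa> \<eta> u v w \<bullet> x - tri_const \<kappa> \<eta> | \<kappa> \<eta>. \<kappa> \<in> {1, -1} \<and> \<eta> \<in> {1, -1}} =
    {\<lambda>x. tri_vec 1 1 u v w \<bullet> x - tri_const 1 1, \<lambda>x. tri_vec 1 (-1) u v w \<bullet> x - tri_const 1 (-1),
     \<lambda>x. tri_vec (-1) 1 u v w \<bullet> x - tri_const (-1) 1,
     \<lambda>x. tri_vec (-1) (-1) u v w \<bullet> x - tri_const (-1) (-1)}"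
    by blast
  moreover have "tri_perimeter u v w = (\<lambda>x. tri_vec 1 1 u v w \<bullet> x - tri_const 1 1)"
    "tri_rooted u v w = (\<lambda>x. tri_vec 1 (-1) u v w \<bullet> x - tri_const 1 (-1))"
    "tri_rooted u w v = (\<lambda>x. tri_vec (-1) 1 u v w \<bullet> x - tri_const (-1) 1)"
    "tri_rooted w v u = (\<lambda>x. tri_vec (-1) (-1) u v w \<bullet> x - tri_const (-1) (-1))"
    by (auto simp: fun_eq_iff tri_perimeter_def tri_rooted_def tri_vec_def tri_const_def
        inner_add_left inner_axis_left insert_commute)
  ultimately show ?thesis
    unfolding triangular_forms_def by (simp only:) blast
qed

text \<open>Since \<open>side S u\<close> squares to 1, the three sign terms combine to a product.
  For signs \<open>\<kappa>\<close>, \<open>\<eta>\<close> it is nonzero on just one of the four cut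
  patterns of the triple.\<close>

lemma tri_vec_cut:
  assumes "distinct [u, v, w]"
  shows "tri_vec \<kappa> \<eta> u v w \<bullet> cut S - tri_const \<kappa> \<eta> =
    - ((1 + \<kappa> * (side S u * side S v)) * (1 + \<eta> * (side S u * side S w)) / 2)"
proof -
  have "(\<kappa> * (side S u * side S v)) * (\<eta> * (side S u * side S w)) =
      \<kappa> * \<eta> * (side S v * side S w)"
    using side_mult_self[of S u] by algebra
  then show ?thesis
    using assms
    by (simp add: tri_vec_def tri_const_def inner_add_left inner_axis_left cut_pair field_simps)
qed

section \<open>Roots of facets that are not triangle inequalities\<close>

lemma side_pattern_exists:
  assumes "distinct [u, v, z]" "{u, v, z} \<subseteq> V" "p \<in> {1, -1}" "q \<in> {1, -1}"
  obtains S where "S \<subseteq> V" "side S u * side S v = p" "side S u * side S z = q"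
proof -
  let ?S = "(if p = 1 then {} else {v}) \<union> (if q = 1 then {} else {z})"
  have "?S \<subseteq> V" "side ?S u * side ?S v = p" "side ?S u * side ?S z = q"
    using assms by (auto simp: side_def)
  then show ?thesis
    using that by blast
qed

text \<open>If no root had the pattern, the form that is nonzero exactly there would vanish on all
  roots and be a multiple of the facet inequality, which would then be a triangle
  inequality.\<close>

lemma facet_root_triple:
  assumes f: "facet_inducing V (nsets V 2) a a0" and nt: "\<not> triangle_inequality V a a0"
    and dist: "distinct [u, v, z]" and V: "{u, v, z} \<subseteq> V"
    and pq: "p \<in> {1, -1}" "q \<in> {1, -1}"
  obtains S where "S \<subseteq> V" "a \<bullet> cut S = a0" "side S u * side S v = p" "side S u * side S z = q"
proof (rule ccontr)
  note ex = that
  assume "\<not> thesis"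
  then have none: "side S u * side S v \<noteq> p \<or> side S u * side S z \<noteq> q"
    if "S \<subseteq> V" "a \<bullet> cut S = a0" for S
    using that ex by blast
  let ?c = "tri_vec p q u v z" and ?k = "tri_const p q"
  have "?c \<in> edge_space (nsets V 2)"
    using dist V unfolding tri_vec_def
    by (intro subspace_add subspace_edge_space axis_in_edge_space) auto
  moreover have "?c \<bullet> cut S = ?k" if "S \<subseteq> V" "a \<bullet> cut S = a0" for S
  proof -
    have "1 + p * (side S u * side S v) = 0 \<or> 1 + q * (side S u * side S z) = 0"
      using none[OF that] pq by (auto simp: side_def split: if_splits)
    then show ?thesis
      using tri_vec_cut[OF dist, of p q S] by auto
  qed
  ultimately obtain \<mu> where \<mu>: "?c = \<mu> *\<^sub>R a" "?k = \<mu> * a0"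
    using facet_inducing_unique[OF f] by blast
  obtain S where S: "S \<subseteq> V" "side S u * side S v = p" "side S u * side S z = q"
    using side_pattern_exists[OF dist V pq] .
  \<comment> \<open>The form is negative here and the facet slack at most 0, so \<open>\<mu>\<close>
    is positive.\<close>
  have "?c \<bullet> cut S - ?k = -2"
    unfolding tri_vec_cut[OF dist] S using pq by auto
  then have "\<mu> * (a \<bullet> cut S - a0) = -2"
    unfolding \<mu> by (simp add: algebra_simps)
  moreover have "a \<bullet> cut S - a0 \<le> 0"
    using facet_inducing_le[OF f S(1)] by simp
  ultimately have "\<mu> > 0"
    by (smt (verit) mult_nonpos_nonpos)
  then have "a \<bullet> x - a0 = (1 / \<mu>) * (?c \<bullet> x - ?k)" for x
    unfolding \<mu> by (simp add: field_simps)
  moreover have "(\<lambda>x. ?c \<bullet> x - ?k) \<in> triangular_forms u v z"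
    unfolding triangular_forms_eq using pq by blast
  ultimately have "triangle_inequality V a a0"
    unfolding triangle_inequality_def using \<open>\<mu> > 0\<close> dist V
    by (metis zero_less_divide_1_iff)
  then show False
    using nt by blast
qed

text \<open>Times \<open>side S u + t * side S v\<close>, the relation becomes affine in the cut and
  vanishes on all roots, so it is a multiple of the facet slack and has constant sign on cuts.
  Moving a third node \<open>y\<close> across suitable roots changes it by \<open>- 4 * c y\<close>
  and by \<open>4 * c y\<close>, so \<open>c y = 0\<close>.\<close>

lemma facet_root_side_relation:
  assumes f: "facet_inducing V (nsets V 2) a a0" and nt: "\<not> triangle_inequality V a a0"
    and uv: "u \<in> V" "v \<in> V" "u \<noteq> v" and z: "z \<in> V - {u, v}" and t: "t \<in> {1, -1}"
    and rel: "\<And>S. S \<subseteq> V \<Longrightarrow> a \<bullet> cut S = a0 \<Longrightarrow> side S u * side S v = t \<Longrightarrow>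
      (\<Sum>y\<in>V. c y * side S y) = 0"
  shows "c z = 0" and "c u + t * c v = 0"
proof -
  let ?V = "V - {u, v}"
  text \<open>\<open>Q\<close> is affine in the cut vector. It is \<open>2 * side S u\<close> times the sum in \<open>rel\<close> if
    \<open>side S u * side S v = t\<close>, and zero otherwise; hence it vanishes on all roots.\<close>
  define Q where "Q S = (\<Sum>y\<in>?V. c y * (side S u * side S y + t * (side S v * side S y))) +
    (c u + t * c v) * (1 + t * (side S u * side S v))" for S
  \<comment> \<open>Obtained from \<open>Q\<close> by
    \<open>side S x * side S y = 1 - 2 * cut S $ {x, y}\<close>.\<close>
  define C where "C = (\<Sum>y\<in>?V. axis {u, y} (-2 * c y) + axis {v, y} (-2 * t * c y)) +
    axis {u, v} (-2 * t * (c u + t * c v))"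
  define C0 where "C0 = - ((\<Sum>y\<in>?V. c y * (1 + t)) + (c u + t * c v) * (1 + t))"
  have C: "C \<in> edge_space (nsets V 2)"
    unfolding C_def using uv
    by (intro subspace_add subspace_edge_space axis_in_edge_space subspace_sum) auto
  have CQ: "C \<bullet> cut S - C0 = Q S" for S
  proof -
    have "C \<bullet> cut S = (\<Sum>y\<in>?V. - 2 * c y * cut S $ {u, y} + (- 2 * t * c y) * cut S $ {v, y}) +
      (-2 * t * (c u + t * c v)) * cut S $ {u, v}"
      unfolding C_def by (simp add: inner_add_left inner_sum_left inner_axis_left)
    also have "\<dots> = (\<Sum>y\<in>?V. c y * (side S u * side S y + t * (side S v * side S y)) - c y * (1 + t)) +
      (c u + t * c v) * (t * (side S u * side S v) - t)"
      using uv by (intro arg_cong2[where f = "(+)"] sum.cong) (auto simp: cut_pair field_simps)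
    finally show ?thesis
      unfolding Q_def C0_def by (simp add: sum_subtractf algebra_simps)
  qed
  have Q_root: "Q S = 0" if S: "S \<subseteq> V" "a \<bullet> cut S = a0" for S
  proof (cases "side S u * side S v = t")
    case True
    then have v: "t * side S v = side S u" and tt: "t * t = 1"
      using t by (auto simp: side_def split: if_splits)
    have "(\<Sum>y\<in>V. c y * side S y) = c u * side S u + c v * side S v + (\<Sum>y\<in>?V. c y * side S y)"
      using uv sum.subset_diff[of "{u, v}" V "\<lambda>y. c y * side S y"] by simp
    then have zero: "c u * side S u + c v * side S v + (\<Sum>y\<in>?V. c y * side S y) = 0"
      using rel[OF S True] by simp
    have sum: "(\<Sum>y\<in>?V. c y * (side S u * side S y + t * (side S v * side S y))) =
      2 * side S u * (\<Sum>y\<in>?V. c y * side S y)"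
      unfolding sum_distrib_left
      by (intro sum.cong refl) (simp add: v mult.assoc[symmetric])
    have two: "1 + t * (side S u * side S v) = 2"
      using True tt by simp
    have uv: "c u + t * c v = side S u * (c u * side S u + c v * side S v)"
      by (simp add: distrib_left mult.left_commute[of "side S u"] True)
    have "Q S = 2 * side S u * (c u * side S u + c v * side S v + (\<Sum>y\<in>?V. c y * side S y))"
      unfolding Q_def sum two uv
      by (simp only: distrib_left distrib_right mult.assoc mult.left_commute[of 2]
          mult.commute[of _ 2] add_ac)
    then show ?thesis
      using zero by simp
  next
    case False
    then have v: "t * side S v = - side S u"
      using t by (auto simp: side_def split: if_splits)
    then have "t * (side S v * side S y) = - (side S u * side S y)" for y
      by (simp add: mult.assoc[symmetric])
    moreover from this have "t * (side S u * side S v) = -1"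
      by (metis mult.commute side_mult_self)
    ultimately show ?thesis
      unfolding Q_def by simp
  qed
  have "C \<bullet> cut S = C0" if "S \<subseteq> V" "a \<bullet> cut S = a0" for S
    using CQ[of S] Q_root[OF that] by simp
  then obtain \<mu> where \<mu>: "C = \<mu> *\<^sub>R a" "C0 = \<mu> * a0"
    using facet_inducing_unique[OF f C] by blast
  have Q_\<mu>: "Q S = \<mu> * (a \<bullet> cut S - a0)" for S
    unfolding CQ[symmetric] \<mu> by (simp add: algebra_simps)
  have zero: "c y = 0" if y: "y \<in> ?V" for y
  proof -
    \<comment> \<open>\<open>Q\<close> is 0 at the chosen root, so its change under moving
      \<open>y\<close> is its new value, \<open>\<mu>\<close> times a slack.\<close>
    have flip: "\<exists>n \<le> 0. - 4 * c y * q = \<mu> * n" if q: "q \<in> {1, -1}" for q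
    proof -
      obtain S where S: "S \<subseteq> V" "a \<bullet> cut S = a0" "side S u * side S v = t" "side S u * side S y = q"
        using facet_root_triple[OF f nt _ _ t q, of u v y] uv y by auto
      define T where "T = (if y \<in> S then S - {y} else insert y S)"
      have T: "T \<subseteq> V" "side T y = - side S y" "\<And>x. x \<noteq> y \<Longrightarrow> side T x = side S x"
        using S(1) y by (auto simp: T_def side_def)
      have uvT: "side T u = side S u" "side T v = side S v"
        using T(3) y by auto
      have "Q T - Q S = (\<Sum>x\<in>?V. c x * (side T u * side T x + t * (side T v * side T x)) -
          c x * (side S u * side S x + t * (side S v * side S x)))"
        unfolding Q_def sum_subtractf by (simp add: uvT)
      also have "\<dots> = (\<Sum>x\<in>?V. if x = y then -2 * c y * (side S u * side S y + t * (side S v * side S y)) else 0)"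
        using T(2,3) by (intro sum.cong) (auto simp: uvT algebra_simps)
      also have "\<dots> = -2 * c y * (side S u * side S y + t * (side S v * side S y))"
        using y by simp
      also have "t * side S v = side S u"
        using t S(3) by (auto simp: side_def split: if_splits)
      then have "t * (side S v * side S y) = q"
        using S(4) by (simp add: mult.assoc[symmetric])
      finally have "Q T - Q S = - 4 * c y * q"
        using S(4) by simp
      then have "- 4 * c y * q = \<mu> * (a \<bullet> cut T - a0)"
        using Q_root[OF S(1,2)] Q_\<mu>[of T] by simp
      moreover have "a \<bullet> cut T - a0 \<le> 0"
        using facet_inducing_le[OF f T(1)] by simp
      ultimately show ?thesis
        by blast
    qed
    \<comment> \<open>\<open>4 * c y\<close> and \<open>- 4 * c y\<close> are both
      \<open>\<mu>\<close> times a nonpositive number, hence both 0.\<close>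
    obtain m n where mn: "m \<le> 0" "n \<le> 0" "- 4 * c y = \<mu> * m" "4 * c y = \<mu> * n"
      using flip[of 1] flip[of "-1"] by auto
    show ?thesis
    proof (cases "\<mu> \<ge> 0")
      case True
      then show ?thesis
        using mn mult_nonneg_nonpos[of \<mu> m] mult_nonneg_nonpos[of \<mu> n] by linarith
    next
      case False
      then show ?thesis
        using mn mult_nonpos_nonpos[of \<mu> m] mult_nonpos_nonpos[of \<mu> n] by linarith
    qed
  qed
  then show "c z = 0"
    using z by blast
  \<comment> \<open>The sign 1 at \<open>z\<close> is arbitrary. As the other coefficients vanish,
    \<open>Q\<close> is \<open>2 * (c u + t * c v)\<close> here.\<close>
  obtain S where S: "S \<subseteq> V" "a \<bullet> cut S = a0" "side S u * side S v = t"
    using facet_root_triple[OF f nt _ _ t, of u v z 1] uv z by auto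
  have "t * t = 1"
    using t by auto
  then show "c u + t * c v = 0"
    using Q_root[OF S(1,2)] zero S(3) unfolding Q_def by simp
qed

text \<open>Otherwise every root with the first state satisfies
  \<open>side S y + q * side S z = 0\<close>, against
  \<open>facet_root_side_relation\<close>.\<close>

lemma facet_root_pairs:
  assumes f: "facet_inducing V (nsets V 2) a a0" and nt: "\<not> triangle_inequality V a a0"
    and dist: "distinct [u, v, y, z]" and V: "{u, v, y, z} \<subseteq> V"
    and pq: "p \<in> {1, -1}" "q \<in> {1, -1}"
  obtains S where "S \<subseteq> V" "a \<bullet> cut S = a0" "side S u * side S v = p" "side S y * side S z = q"
proof (rule ccontr)
  note ex = that
  assume "\<not> thesis"
  then have none: "side S y * side S z \<noteq> q"
    if "S \<subseteq> V" "a \<bullet> cut S = a0" "side S u * side S v = p" for S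
    using that ex by blast
  define c where "c x = (if x = y then 1 else if x = z then q else 0)" for x
  have "(\<Sum>x\<in>V. c x * side S x) = 0"
    if "S \<subseteq> V" "a \<bullet> cut S = a0" "side S u * side S v = p" for S
  proof -
    have "(\<Sum>x\<in>V. c x * side S x) = (\<Sum>x\<in>{y, z}. c x * side S x)"
      using V by (intro sum.mono_neutral_right) (auto simp: c_def)
    also have "\<dots> = side S y + q * side S z"
      using dist by (auto simp: c_def)
    also have "\<dots> = 0"
      using none[OF that] pq by (auto simp: side_def split: if_splits)
    finally show ?thesis .
  qed
  then have "c y = 0"
    using facet_root_side_relation(1)[OF f nt, of u v y p c] dist V pq by auto
  then show False
    by (simp add: c_def)
qed

section \<open>Lifting facets through a triangular elimination\<close>

lemma inner_cut_insert_diff: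
  assumes b: "b \<in> edge_space E" and E: "E \<subseteq> nsets V 2" and x: "x \<in> V" "x \<notin> S"
  shows "b \<bullet> cut (insert x S) - b \<bullet> cut S = (\<Sum>y\<in>V - {x}. b $ {x, y} * side S y)"
proof -
  let ?g = "\<lambda>h. b $ h * (cut (insert x S) $ h - cut S $ h)"
  have "b \<bullet> cut (insert x S) - b \<bullet> cut S = (\<Sum>h\<in>UNIV. ?g h)"
    by (simp add: inner_vec_def right_diff_distrib sum_subtractf)
  \<comment> \<open>Only pairs containing \<open>x\<close> change, so the sum runs over the other
    endpoint.\<close>
  also have "\<dots> = (\<Sum>h\<in>(\<lambda>y. {x, y}) ` (V - {x}). ?g h)"
  proof (rule sum.mono_neutral_right)
    show "\<forall>h \<in> UNIV - (\<lambda>y. {x, y}) ` (V - {x}). ?g h = 0"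
    proof
      fix h assume h: "h \<in> UNIV - (\<lambda>y. {x, y}) ` (V - {x})"
      show "?g h = 0"
      proof (cases "h \<in> E")
        case True
        then obtain y z where yz: "h = {y, z}" "y \<in> V" "z \<in> V" "y \<noteq> z"
          using E by (meson nsets2_E subsetD)
        then have "x \<notin> h"
          using h by (auto simp: insert_commute)
        then have "insert x S \<inter> h = S \<inter> h"
          by blast
        then show ?thesis
          by (simp add: cut_vector_def)
      next
        case False
        then show ?thesis
          using b by (simp add: edge_space_def)
      qed
    qed
  qed auto
  also have "\<dots> = (\<Sum>y\<in>V - {x}. ?g {x, y})"
    by (subst sum.reindex) (auto simp: inj_on_def doubleton_eq_iff)
  also have "\<dots> = (\<Sum>y\<in>V - {x}. b $ {x, y} * side S y)"
    using x by (intro sum.cong) (auto simp: cut_pair side_def)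
  finally show ?thesis .
qed

lemma tri_vec_nth:
  "tri_vec \<kappa> \<eta> u v w $ h = (if h = {u, v} then \<kappa> else 0) + (if h = {u, w} then \<eta> else 0) +
    (if h = {v, w} then \<kappa> * \<eta> else 0)"
  by (auto simp: tri_vec_def axis_def)

text \<open>By \<open>indep\<close>, adjacent new nodes belong to disjoint edges, as
  \<open>facet_root_pairs\<close> requires; \<open>card V \<ge> 3\<close> gives
  \<open>facet_root_side_relation\<close> its third node.\<close>

lemma facet_inducing_triangular_elimination:
  fixes V V' :: "'v::finite set"
  assumes card: "card V \<ge> 3"
    and gte: "graph_triangular_elimination V (nsets V 2) F w V' E'"
    and indep: "\<And>e f. e \<in> F \<Longrightarrow> f \<in> F \<Longrightarrow> {w e, w f} \<in> E' \<Longrightarrow> e \<inter> f = {}"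
    and f: "facet_inducing V (nsets V 2) a a0" and nt: "\<not> triangle_inequality V a a0"
    and ite: "inequality_triangular_elimination (nsets V 2) F w E' a a0 a' a0'"
  shows "facet_inducing V' E' a' a0'"
proof -
  let ?E = "nsets V 2"
  have E': "E' \<subseteq> nsets V' 2" and F: "F \<subseteq> ?E" and inj: "inj_on w F" and wV: "w ` F \<inter> V = {}"
    and V': "V' = V \<union> w ` F" and EF: "E' \<inter> ?E = ?E - F"
    using gte by (auto simp: graph_triangular_elimination_def simple_graph_def)
  have a: "a \<in> edge_space ?E" and a': "a' \<in> edge_space E'"
    using ite by (auto simp: inequality_triangular_elimination_def)
  obtain D where D: "\<forall>e\<in>F. \<exists>u v. e = {u, v} \<and> D e \<in> triangular_forms u v (w e)"
    and aff: "\<And>x. a' \<bullet> x - a0' = a \<bullet> x - a0 + (\<Sum>e\<in>F. \<bar>a $ e\<bar> * D e x)"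
    using ite unfolding inequality_triangular_elimination_def by blast
  have "\<forall>e\<in>F. \<exists>u v \<kappa> \<eta>. e = {u, v} \<and> \<kappa> \<in> {1, -1} \<and> \<eta> \<in> {1, -1} \<and>
      D e = (\<lambda>x. tri_vec \<kappa> \<eta> u v (w e) \<bullet> x - tri_const \<kappa> \<eta>)"
  proof
    fix e assume "e \<in> F"
    then obtain u v where "e = {u, v}" "D e \<in> triangular_forms u v (w e)"
      using D by blast
    then show "\<exists>u v \<kappa> \<eta>. e = {u, v} \<and> \<kappa> \<in> {1, -1} \<and> \<eta> \<in> {1, -1} \<and>
        D e = (\<lambda>x. tri_vec \<kappa> \<eta> u v (w e) \<bullet> x - tri_const \<kappa> \<eta>)"
      unfolding triangular_forms_eq by blast
  qed
  then obtain u v and \<kappa> \<eta> :: "'v set \<Rightarrow> real" where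
    uv: "\<And>e. e \<in> F \<Longrightarrow> e = {u e, v e}" and
    \<kappa>: "\<And>e. e \<in> F \<Longrightarrow> \<kappa> e \<in> {1, -1}" and \<eta>: "\<And>e. e \<in> F \<Longrightarrow> \<eta> e \<in> {1, -1}" and
    D_eq: "\<And>e. e \<in> F \<Longrightarrow>
      D e = (\<lambda>x. tri_vec (\<kappa> e) (\<eta> e) (u e) (v e) (w e) \<bullet> x - tri_const (\<kappa> e) (\<eta> e))"
    by metis
  define d where "d e = tri_vec (\<kappa> e) (\<eta> e) (u e) (v e) (w e)" for e
  define k where "k e = tri_const (\<kappa> e) (\<eta> e)" for e
  have De: "D e x = d e \<bullet> x - k e" if "e \<in> F" for e x
    using D_eq[OF that] by (simp add: d_def k_def)
  have uvV: "u e \<in> V" "v e \<in> V" "u e \<noteq> v e" and wnV: "w e \<notin> V" if "e \<in> F" for e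
  proof -
    have "{u e, v e} \<in> ?E"
      using uv[OF that] F that by auto
    then show "u e \<in> V" "v e \<in> V" "u e \<noteq> v e"
      by auto
    show "w e \<notin> V"
      using wV that by blast
  qed
  have dist: "distinct [u e, v e, w e]" if "e \<in> F" for e
    using uvV[OF that] wnV[OF that] by auto
  have w_eq: "w e = w f \<longleftrightarrow> e = f" if "e \<in> F" "f \<in> F" for e f
    using inj that by (auto dest: inj_onD)
  have d_nth: "d e $ h = (if h = e then \<kappa> e else 0)" if "e \<in> F" "h \<in> ?E" for e h
  proof -
    have "h \<noteq> {u e, w e}" "h \<noteq> {v e, w e}"
      using that(2) wnV[OF that(1)] by auto
    then show ?thesis
      using uv[OF that(1)] by (simp add: d_def tri_vec_nth)
  qed
  have d_cut: "d e \<bullet> cut A - k e =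
      - ((1 + \<kappa> e * (side A (u e) * side A (v e))) * (1 + \<eta> e * (side A (u e) * side A (w e))) / 2)"
    if "e \<in> F" for e A
    unfolding d_def k_def by (rule tri_vec_cut[OF dist[OF that]])
  have a'_eq: "a' = a + (\<Sum>e\<in>F. \<bar>a $ e\<bar> *\<^sub>R d e)" and a0'_eq: "a0' = a0 + (\<Sum>e\<in>F. \<bar>a $ e\<bar> * k e)"
  proof -
    have aff': "a' \<bullet> x - a0' = a \<bullet> x - a0 + (\<Sum>e\<in>F. \<bar>a $ e\<bar> * (d e \<bullet> x - k e))" for x
      unfolding aff by (simp add: De)
    show a0'_eq: "a0' = a0 + (\<Sum>e\<in>F. \<bar>a $ e\<bar> * k e)"
      using aff'[of 0] by (simp add: sum_negf)
    have "a' \<bullet> x = (a + (\<Sum>e\<in>F. \<bar>a $ e\<bar> *\<^sub>R d e)) \<bullet> x" for x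
      using aff'[of x] unfolding a0'_eq
      by (simp add: inner_add_left inner_sum_left right_diff_distrib sum_subtractf)
    then show "a' = a + (\<Sum>e\<in>F. \<bar>a $ e\<bar> *\<^sub>R d e)"
      using vector_eq_rdot by blast
  qed
  \<comment> \<open>As \<open>e\<close> is not in \<open>E'\<close>, its own form must cancel
    \<open>a $ e\<close>; no other form has a coefficient at \<open>e\<close>.\<close>
  have \<kappa>_sign: "\<kappa> e * a $ e = - \<bar>a $ e\<bar>" if e: "e \<in> F" for e
  proof -
    have "e \<in> ?E" "e \<notin> E'"
      using e F EF by auto
    then have "0 = a' $ e"
      using a' by (simp add: edge_space_def)
    also have "\<dots> = a $ e + (\<Sum>f\<in>F. \<bar>a $ f\<bar> * d f $ e)"
      unfolding a'_eq by simp
    also have "(\<Sum>f\<in>F. \<bar>a $ f\<bar> * d f $ e) = (\<Sum>f\<in>F. if e = f then \<bar>a $ e\<bar> * \<kappa> e else 0)"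
      using \<open>e \<in> ?E\<close> by (intro sum.cong) (auto simp: d_nth)
    also have "\<dots> = \<bar>a $ e\<bar> * \<kappa> e"
      using e by simp
    finally show ?thesis
      using \<kappa>[OF e] by auto
  qed
  \<comment> \<open>The new slack is the slack of the trace on \<open>V\<close> plus weighted
    triangular forms.\<close>
  have slack: "a' \<bullet> cut A - a0' = (a \<bullet> cut (A \<inter> V) - a0) + (\<Sum>e\<in>F. \<bar>a $ e\<bar> * (d e \<bullet> cut A - k e))" for A
    unfolding inner_cut_Int[OF a nsets_2_subset_Pow] a'_eq a0'_eq
    by (simp add: inner_add_left inner_sum_left right_diff_distrib sum_subtractf)
  have d_le: "d e \<bullet> cut A - k e \<le> 0" if "e \<in> F" for e A
    unfolding d_cut[OF that] using \<kappa>[OF that] \<eta>[OF that]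
    by (auto simp: side_def)
  have slack_le: "a' \<bullet> cut A - a0' \<le> a \<bullet> cut (A \<inter> V) - a0" for A
    unfolding slack using d_le by (simp add: sum_nonpos mult_nonneg_nonpos)

  text \<open>Adding \<open>w ` g S\<close> to \<open>S\<close> makes every triangular form tight.\<close>
  define g where "g S = {e \<in> F. \<eta> e * side S (u e) = 1}" for S
  have Int_V: "(S \<union> w ` N) \<inter> V = S" if "S \<subseteq> V" "N \<subseteq> F" for S N
    using that wnV by blast
  have side_V: "side (S \<union> w ` N) y = side S y" if "N \<subseteq> F" "y \<in> V" for S N y
    using that wnV by (auto simp: side_def)
  have side_w: "side (S \<union> w ` N) (w e) = (if e \<in> N then -1 else 1)"
    if "S \<subseteq> V" "N \<subseteq> F" "e \<in> F" for S N e
    using that wnV w_eq by (auto simp: side_def image_iff)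
  have tight: "d e \<bullet> cut (S \<union> w ` N) = k e"
    if "S \<subseteq> V" "N \<subseteq> F" "e \<in> F" "side S (u e) * side S (v e) = - \<kappa> e \<or> (e \<in> N \<longleftrightarrow> e \<in> g S)" for S N e
  proof -
    have "1 + \<kappa> e * (side S (u e) * side S (v e)) = 0 \<or>
        1 + \<eta> e * (side S (u e) * (if e \<in> N then -1 else 1)) = 0"
      using that(3,4) \<kappa>[OF that(3)] \<eta>[OF that(3)] by (auto simp: g_def side_def split: if_splits)
    then have "d e \<bullet> cut (S \<union> w ` N) - k e = 0"
      unfolding d_cut[OF that(3)] side_w[OF that(1-3)]
        side_V[OF that(2) uvV(1)[OF that(3)]] side_V[OF that(2) uvV(2)[OF that(3)]]
      by auto
    then show ?thesis
      by simp
  qed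
  \<comment> \<open>An old root extends to a new one, with \<open>w e\<close> on either side if the
    state of \<open>e\<close> is \<open>- \<kappa> e\<close> and placed by \<open>g S\<close>
    otherwise.\<close>
  have root: "a' \<bullet> cut (S \<union> w ` N) = a0'"
    if "S \<subseteq> V" "a \<bullet> cut S = a0" "N \<subseteq> F"
      "\<And>e. e \<in> F \<Longrightarrow> side S (u e) * side S (v e) = - \<kappa> e \<or> (e \<in> N \<longleftrightarrow> e \<in> g S)" for S N
    using slack[of "S \<union> w ` N"] that by (simp add: Int_V tight)

  obtain T where T: "T \<subseteq> V" "a \<bullet> cut T < a0"
    using facet_inducing_strict[OF f] .
  obtain U where U: "U \<subseteq> V" "a \<bullet> cut U = a0"
    using facet_inducing_root[OF f] .
  show ?thesis
  proof (rule facet_inducingI[OF a'])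
    show "a' \<bullet> cut A \<le> a0'" for A
      using slack_le[of A] facet_inducing_le[OF f, of "A \<inter> V"] by simp
    \<comment> \<open>A non-root of the old inequality serves with every new node outside.\<close>
    show "T \<subseteq> V'" "a' \<bullet> cut T < a0'"
      using slack_le[of T] T V' by (auto simp: Int_absorb2)
    show "U \<union> w ` g U \<subseteq> V'" "a' \<bullet> cut (U \<union> w ` g U) = a0'"
      using U V' root[of U "g U"] by (auto simp: g_def)
  next
    fix b b0
    assume b: "b \<in> edge_space E'" and van: "\<And>A. A \<subseteq> V' \<Longrightarrow> a' \<bullet> cut A = a0' \<Longrightarrow> b \<bullet> cut A = b0"
    have b_root: "b \<bullet> cut (S \<union> w ` N) = b0"
      if "S \<subseteq> V" "a \<bullet> cut S = a0" "N \<subseteq> F"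
        "\<And>e. e \<in> F \<Longrightarrow> side S (u e) * side S (v e) = - \<kappa> e \<or> (e \<in> N \<longleftrightarrow> e \<in> g S)" for S N
    proof (rule van)
      show "S \<union> w ` N \<subseteq> V'"
        using that(1,3) V' by blast
    qed (rule root[OF that])
    \<comment> \<open>The node \<open>w e\<close> is free: both placements are roots, and their
      difference is the sum over its edges.\<close>
    have balance: "(\<Sum>y\<in>V' - {w e}. b $ {w e, y} * side (S \<union> w ` N) y) = 0"
      if S: "S \<subseteq> V" "a \<bullet> cut S = a0" and e: "e \<in> F" "side S (u e) * side S (v e) = - \<kappa> e"
        and N: "N \<subseteq> F - {e}"
          "\<And>h. h \<in> F - {e} \<Longrightarrow> side S (u h) * side S (v h) = - \<kappa> h \<or> (h \<in> N \<longleftrightarrow> h \<in> g S)" for S e N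
    proof -
      have "w e \<notin> S \<union> w ` N"
        using S(1) e(1) N(1) wnV w_eq by blast
      then have "(\<Sum>y\<in>V' - {w e}. b $ {w e, y} * side (S \<union> w ` N) y) =
          b \<bullet> cut (insert (w e) (S \<union> w ` N)) - b \<bullet> cut (S \<union> w ` N)"
        using e(1) V' by (simp add: inner_cut_insert_diff[OF b E'])
      also have "insert (w e) (S \<union> w ` N) = S \<union> w ` insert e N"
        by blast
      also have "b \<bullet> cut (S \<union> w ` insert e N) = b0"
        using N e by (intro b_root[OF S]) auto
      also have "b \<bullet> cut (S \<union> w ` N) = b0"
        using N e by (intro b_root[OF S]) auto
      finally show ?thesis
        by simp
    qed
    \<comment> \<open>With both nodes free, toggling \<open>w h\<close> in the balance at
      \<open>w e\<close> alters only the term of \<open>w h\<close>.\<close>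
    have b_ww: "b $ {w e, w h} = 0" if eh: "e \<in> F" "h \<in> F" "e \<noteq> h" for e h
    proof (cases "{w e, w h} \<in> E'")
      case True
      then have "{u e, v e} \<inter> {u h, v h} = {}"
        using indep eh uv by metis
      then have "distinct [u e, v e, u h, v h]"
        using uvV[OF eh(1)] uvV[OF eh(2)] by auto
      moreover have "{u e, v e, u h, v h} \<subseteq> V"
        using uvV[OF eh(1)] uvV[OF eh(2)] by auto
      moreover have "- \<kappa> e \<in> {1, -1}" "- \<kappa> h \<in> {1, -1}"
        using \<kappa>[OF eh(1)] \<kappa>[OF eh(2)] by auto
      ultimately obtain S where S: "S \<subseteq> V" "a \<bullet> cut S = a0"
        and free: "side S (u e) * side S (v e) = - \<kappa> e" "side S (u h) * side S (v h) = - \<kappa> h"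
        using facet_root_pairs[OF f nt] by metis
      \<comment> \<open>Without \<open>e\<close> and \<open>h\<close>, the set places all other new
        nodes tightly and leaves both free ones outside.\<close>
      define N where "N = g S - {e, h}"
      have N: "N \<subseteq> F - {e}" "insert h N \<subseteq> F - {e}"
        using eh by (auto simp: N_def g_def)
      have "(\<Sum>y\<in>V' - {w e}. b $ {w e, y} * side (S \<union> w ` N) y) = 0"
        by (rule balance[OF S eh(1) free(1) N(1)]) (use free eh in \<open>auto simp: N_def\<close>)
      moreover have "(\<Sum>y\<in>V' - {w e}. b $ {w e, y} * side (S \<union> w ` insert h N) y) = 0"
        by (rule balance[OF S eh(1) free(1) N(2)]) (use free eh in \<open>auto simp: N_def\<close>)
      ultimately have "0 = (\<Sum>y\<in>V' - {w e}. b $ {w e, y} * side (S \<union> w ` N) y -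
          b $ {w e, y} * side (S \<union> w ` insert h N) y)"
        by (simp add: sum_subtractf)
      also have "\<dots> = (\<Sum>y\<in>V' - {w e}. if y = w h then 2 * b $ {w e, w h} else 0)"
      proof (intro sum.cong refl)
        fix y
        have "w h \<notin> S \<union> w ` N"
          using S(1) eh(2) N(1) wnV w_eq by (auto simp: N_def g_def)
        then show "b $ {w e, y} * side (S \<union> w ` N) y - b $ {w e, y} * side (S \<union> w ` insert h N) y =
            (if y = w h then 2 * b $ {w e, w h} else 0)"
          by (auto simp: side_def)
      qed
      also have "\<dots> = 2 * b $ {w e, w h}"
        using eh V' w_eq by simp
      finally show ?thesis
        by simp
    qed (use b in \<open>simp add: edge_space_def\<close>)
    \<comment> \<open>Terms at new nodes drop out of the balance by \<open>b_ww\<close>, leaving a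
      relation on \<open>V\<close>.\<close>
    have rel: "(\<Sum>y\<in>V. b $ {w e, y} * side S y) = 0"
      if e: "e \<in> F" and S: "S \<subseteq> V" "a \<bullet> cut S = a0" "side S (u e) * side S (v e) = - \<kappa> e" for e S
    proof -
      have N: "g S - {e} \<subseteq> F - {e}"
        by (auto simp: g_def)
      have "(\<Sum>y\<in>V. b $ {w e, y} * side S y) =
          (\<Sum>y\<in>V. b $ {w e, y} * side (S \<union> w ` (g S - {e})) y)"
        by (intro sum.cong refl) (simp add: side_V subset_trans[OF N Diff_subset])
      also have "\<dots> = (\<Sum>y\<in>V' - {w e}. b $ {w e, y} * side (S \<union> w ` (g S - {e})) y)"
      proof (rule sum.mono_neutral_left)
        show "V \<subseteq> V' - {w e}"
          using V' wnV[OF e] by blast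
        show "\<forall>y\<in>V' - {w e} - V. b $ {w e, y} * side (S \<union> w ` (g S - {e})) y = 0"
          using V' b_ww[OF e] by fastforce
      qed simp
      also have "\<dots> = 0"
        by (rule balance[OF S(1,2) e S(3) N]) auto
      finally show ?thesis .
    qed
    have b_wz: "b $ {w e, z} = 0" if e: "e \<in> F" and z: "z \<in> V - {u e, v e}" for e z
      using facet_root_side_relation(1)[OF f nt uvV[OF e] z, of "- \<kappa> e" "\<lambda>y. b $ {w e, y}"]
        rel[OF e] \<kappa>[OF e] by auto
    \<comment> \<open>The multiple of \<open>d e\<close> that matches \<open>b\<close> around
      \<open>w e\<close>; \<open>\<eta> e\<close> is its own inverse.\<close>
    define \<gamma> where "\<gamma> e = \<eta> e * b $ {w e, u e}" for e
    have b_wu: "b $ {w e, u e} = \<gamma> e * \<eta> e" if e: "e \<in> F" for e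
      using \<eta>[OF e] by (auto simp: \<gamma>_def)
    have b_wv: "b $ {w e, v e} = \<gamma> e * (\<kappa> e * \<eta> e)" if e: "e \<in> F" for e
    proof -
      have "V - {u e, v e} \<noteq> {}"
      proof
        assume "V - {u e, v e} = {}"
        then have "card V \<le> card {u e, v e}"
          by (intro card_mono) auto
        then show False
          using card uvV[OF e] by simp
      qed
      then obtain z where "z \<in> V - {u e, v e}"
        by blast
      then have "b $ {w e, u e} + (- \<kappa> e) * b $ {w e, v e} = 0"
        using facet_root_side_relation(2)[OF f nt uvV[OF e], of z "- \<kappa> e" "\<lambda>y. b $ {w e, y}"]
          rel[OF e] \<kappa>[OF e] by auto
      then show ?thesis
        using \<kappa>[OF e] \<eta>[OF e] by (auto simp: \<gamma>_def)
    qed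
    \<comment> \<open>Subtracting the forms clears all coordinates at new nodes.\<close>
    define C where "C = b - (\<Sum>e\<in>F. \<gamma> e *\<^sub>R d e)"
    define C0 where "C0 = b0 - (\<Sum>e\<in>F. \<gamma> e * k e)"
    have C: "C \<in> edge_space ?E"
      unfolding edge_space_def
    proof (intro CollectI allI impI)
      fix h assume h: "h \<notin> ?E"
      have "b $ h = (\<Sum>e\<in>F. \<gamma> e * d e $ h)"
      \<comment> \<open>A coordinate off \<open>?E\<close> is a pair with a new node, or lies in
        neither edge set.\<close>
      proof (cases "\<exists>e\<in>F. \<exists>y\<in>V'. h = {w e, y} \<and> y \<noteq> w e")
        case True
        then obtain e y where e: "e \<in> F" and y: "y \<in> V'" "y \<noteq> w e" and hey: "h = {w e, y}"
          by blast
        show ?thesis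
        proof (cases "y \<in> V")
          case True
          \<comment> \<open>No form other than \<open>d e\<close> has a coefficient at
            \<open>w e\<close>.\<close>
          have "(\<Sum>i\<in>F. \<gamma> i * d i $ h) = (\<Sum>i\<in>F. if i = e then \<gamma> e * d e $ h else 0)"
          proof (intro sum.cong refl)
            fix i assume i: "i \<in> F"
            show "\<gamma> i * d i $ h = (if i = e then \<gamma> e * d e $ h else 0)"
            proof (cases "i = e")
              case False
              have "w e \<in> h" "w i \<notin> h"
                using i e True False wnV w_eq by (auto simp: hey)
              then have "h \<noteq> {u i, v i}" "h \<noteq> {u i, w i}" "h \<noteq> {v i, w i}"
                using uvV[OF i] wnV[OF e] by auto
              then show ?thesis
                using False by (simp add: d_def tri_vec_nth)
            qed simp
          qed
          also have "\<dots> = \<gamma> e * d e $ h"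
            using e by simp
          also have "\<dots> = b $ h"
          proof -
            have "d e $ h = (if y = u e then \<eta> e else if y = v e then \<kappa> e * \<eta> e else 0)"
            proof -
              have "w e \<in> h"
                by (simp add: hey)
              then have "h \<noteq> {u e, v e}"
                using uvV[OF e] wnV[OF e] by auto
              moreover have "h = {x, w e} \<longleftrightarrow> y = x" for x
                using y(2) by (auto simp: hey doubleton_eq_iff)
              ultimately show ?thesis
                using uvV(3)[OF e] by (simp add: d_def tri_vec_nth)
            qed
            then show ?thesis
              using b_wu[OF e] b_wv[OF e] b_wz[OF e, of y] True by (auto simp: hey)
          qed
          finally show ?thesis
            by simp
        next
          case False
          then obtain i where i: "i \<in> F" "y = w i"
            using y V' by blast
          \<comment> \<open>A form has no coefficient between two new nodes.\<close>
          have "d j $ h = 0" if j: "j \<in> F" for j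
          proof -
            have "h \<inter> V = {}"
              using wnV[OF e] wnV[OF i(1)] i(2) hey by auto
            then have "h \<noteq> {u j, v j}" "h \<noteq> {u j, w j}" "h \<noteq> {v j, w j}"
              using uvV[OF j] by auto
            then show ?thesis
              by (simp add: d_def tri_vec_nth)
          qed
          then show ?thesis
            using b_ww[OF e i(1)] y(2) i(2) hey by auto
        qed
      next
        case False
        have "h \<notin> E'"
        proof
          assume "h \<in> E'"
          then obtain x y where "h = {x, y}" "x \<in> V'" "y \<in> V'" "x \<noteq> y"
            using E' by (meson nsets2_E subsetD)
          then show False
            using False h V' by (auto simp: insert_commute)
        qed
        moreover have "d e $ h = 0" if e: "e \<in> F" for e
        proof -
          have "h \<noteq> {x, w e}" if "x \<in> V" for x
            using False e that wnV[OF e] V' by (metis UnI1 insert_commute)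
          moreover have "h \<noteq> {u e, v e}"
            using h uvV[OF e] by auto
          ultimately show ?thesis
            using uvV[OF e] by (simp add: d_def tri_vec_nth)
        qed
        ultimately show ?thesis
          using b by (simp add: edge_space_def)
      qed
      then show "C $ h = 0"
        by (simp add: C_def)
    qed
    have "C \<bullet> cut S = C0" if S: "S \<subseteq> V" "a \<bullet> cut S = a0" for S
    proof -
      have gF: "g S \<subseteq> F"
        by (auto simp: g_def)
      let ?A = "S \<union> w ` g S"
      \<comment> \<open>\<open>C\<close> ignores new nodes, so these may be placed by
        \<open>g S\<close>, which makes all forms tight.\<close>
      have "C \<bullet> cut S = C \<bullet> cut ?A"
        using inner_cut_Int[OF C nsets_2_subset_Pow, of ?A] Int_V[OF S(1) gF] by simp
      also have "\<dots> = b \<bullet> cut ?A - (\<Sum>e\<in>F. \<gamma> e * (d e \<bullet> cut ?A))"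
        by (simp add: C_def inner_diff_left inner_sum_left)
      also have "b \<bullet> cut ?A = b0"
        using gF by (intro b_root[OF S]) auto
      finally show ?thesis
        using tight[OF S(1) gF] by (simp add: C0_def)
    qed
    then obtain \<mu> where \<mu>: "C = \<mu> *\<^sub>R a" "C0 = \<mu> * a0"
      using facet_inducing_unique[OF f C] by blast
    \<comment> \<open>Both \<open>b\<close> and the forms of other edges vanish at \<open>e\<close>,
      so comparing \<open>C\<close> with \<open>\<mu> *\<^sub>R a\<close> there determines
      \<open>\<gamma> e\<close>.\<close>
    have \<gamma>_eq: "\<gamma> e = \<mu> * \<bar>a $ e\<bar>" if e: "e \<in> F" for e
    proof -
      have eE: "e \<in> ?E" "e \<notin> E'"
        using e F EF by auto
      have "\<mu> * a $ e = C $ e"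
        by (simp add: \<mu>)
      also have "\<dots> = - (\<Sum>i\<in>F. \<gamma> i * d i $ e)"
        unfolding C_def using b eE by (simp add: edge_space_def)
      also have "(\<Sum>i\<in>F. \<gamma> i * d i $ e) = (\<Sum>i\<in>F. if e = i then \<gamma> e * \<kappa> e else 0)"
        using eE by (intro sum.cong) (auto simp: d_nth)
      also have "\<dots> = \<gamma> e * \<kappa> e"
        using e by simp
      finally show ?thesis
        using \<kappa>[OF e] \<kappa>_sign[OF e] by auto
    qed
    have "b = C + (\<Sum>e\<in>F. \<gamma> e *\<^sub>R d e)" "b0 = C0 + (\<Sum>e\<in>F. \<gamma> e * k e)"
      by (simp_all add: C_def C0_def)
    then have "b = \<mu> *\<^sub>R a' \<and> b0 = \<mu> * a0'"
      unfolding a'_eq a0'_eq \<mu>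
      by (simp add: \<gamma>_eq scaleR_add_right scaleR_sum_right distrib_left sum_distrib_left mult.assoc)
    then show "\<exists>\<mu>. b = \<mu> *\<^sub>R a' \<and> b0 = \<mu> * a0'"
      by blast
  qed
qed

section \<open>Elimination of the cliques on the parts of a partition\<close>

theorem theorem4p1:
  fixes V V' :: "'v::finite set" and E E' F :: "'v set set"
    and P W :: "nat \<Rightarrow> 'v set" and w :: "'v set \<Rightarrow> 'v" and n m :: nat
  assumes "card V = n" and "n \<ge> 5" and "E = nsets V 2"
    and "disjoint_family_on P {1..m}" and "(\<Union>l\<in>{1..m}. P l) = V"
    and "F = (\<Union>l\<in>{1..m}. nsets (P l) 2)"
    and "simple_graph V' E'"
    and "card V' = n + (\<Sum>l=1..m. card (P l) choose 2)"
    and "\<And>l. l \<in> {1..m} \<Longrightarrow> W l = w ` nsets (P l) 2"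
    and "V' = V \<union> (\<Union>l\<in>{1..m}. W l)"
    and "E' \<inter> nsets V 2 = multipartite_edges {1..m} P"
    and "\<And>l. l \<in> {1..m} \<Longrightarrow> indep (W l) E'"
    and "\<And>l u v. \<lbrakk>l \<in> {1..m}; u \<in> P l; v \<in> P l; u \<noteq> v\<rbrakk> \<Longrightarrow>
           {u, w {u, v}} \<in> E' \<and> {v, w {u, v}} \<in> E'"
  shows "graph_triangular_elimination V E F w V' E' \<and>
    (\<forall>a a0 a' a0'.
       facet_inducing V E a a0 \<and> \<not> triangle_inequality V a a0 \<and>
       inequality_triangular_elimination E F w E' a a0 a' a0' \<longrightarrow>
       facet_inducing V' E' a' a0')"
proof -
  note cardV = assms(1) and n5 = assms(2) and E = assms(3) and disj = assms(4) and UnP = assms(5)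
    and F = assms(6) and graph = assms(7) and cardV' = assms(8) and W = assms(9) and V' = assms(10)
    and cross = assms(11) and ind = assms(12) and edges = assms(13)
  have P_disj: "P k \<inter> P l = {}" if "k \<in> {1..m}" "l \<in> {1..m}" "k \<noteq> l" for k l
    using disj that by (auto simp: disjoint_family_on_def)
  have FE: "F \<subseteq> E"
    unfolding F E using UnP by (intro UN_least nsets_mono) blast
  have V'_eq: "V' = V \<union> w ` F"
    unfolding V' F using W by auto
  have cardF: "card F = (\<Sum>l=1..m. card (P l) choose 2)"
  proof -
    have "nsets (P k) 2 \<inter> nsets (P l) 2 = {}" if "k \<in> {1..m}" "l \<in> {1..m}" "k \<noteq> l" for k l
      using P_disj[OF that] by (auto simp: nsets_2_eq doubleton_eq_iff)
    then have "card F = (\<Sum>l=1..m. card (nsets (P l) 2))"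
      unfolding F by (intro card_UN_disjoint) auto
    then show ?thesis
      by (simp add: nsets_def n_subsets)
  qed
  have card_Un: "card V' + card (V \<inter> w ` F) = card V + card (w ` F)"
    unfolding V'_eq using card_Un_Int[of V "w ` F"] by simp
  \<comment> \<open>The node count leaves no room for coincidences:
    \<open>card V' = card V + card F\<close> forces \<open>w\<close> to be injective on
    \<open>F\<close> with values off \<open>V\<close>.\<close>
  have "card (w ` F) \<le> card F"
    by (simp add: card_image_le)
  then have "card (w ` F) = card F" "card (V \<inter> w ` F) = 0"
    using card_Un cardV cardV' cardF by linarith+
  then have inj: "inj_on w F" and wV: "w ` F \<inter> V = {}"
    by (auto simp: eq_card_imp_inj_on)
  \<comment> \<open>The parts are disjoint and cover \<open>V\<close>, so an edge lies in no clique
    exactly if it joins two parts.\<close>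
  have multi: "multipartite_edges {1..m} P = E - F"
  proof
    show "multipartite_edges {1..m} P \<subseteq> E - F"
    proof
      fix e assume "e \<in> multipartite_edges {1..m} P"
      then obtain x y k l where e: "e = {x, y}" "k \<in> {1..m}" "l \<in> {1..m}" "k \<noteq> l" "x \<in> P k" "y \<in> P l"
        unfolding multipartite_edges_def by blast
      then have "x \<noteq> y"
        using P_disj by blast
      moreover have "e \<notin> nsets (P j) 2" if "j \<in> {1..m}" for j
        using that e P_disj by auto blast
      ultimately show "e \<in> E - F"
        unfolding E F using UnP e by auto
    qed
    show "E - F \<subseteq> multipartite_edges {1..m} P"
    proof
      fix e assume e: "e \<in> E - F"
      then obtain x y where xy: "e = {x, y}" "x \<in> V" "y \<in> V" "x \<noteq> y"
        unfolding E by (meson DiffD1 nsets2_E)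
      then obtain k l where kl: "k \<in> {1..m}" "l \<in> {1..m}" "x \<in> P k" "y \<in> P l"
        using UnP by blast
      then have "k \<noteq> l"
        using e xy unfolding F by auto
      then show "e \<in> multipartite_edges {1..m} P"
        unfolding multipartite_edges_def using kl xy by blast
    qed
  qed
  have gte: "graph_triangular_elimination V E F w V' E'"
    unfolding graph_triangular_elimination_def
  proof (intro conjI)
    show "\<forall>e\<in>F. \<forall>u\<in>e. {w e, u} \<in> E'"
    proof (intro ballI)
      fix e u assume e: "e \<in> F" "u \<in> e"
      then obtain l where l: "l \<in> {1..m}" "e \<in> nsets (P l) 2"
        unfolding F by blast
      obtain x y where "e = {x, y}" "x \<in> P l" "y \<in> P l" "x \<noteq> y"
        using l(2) by (rule nsets2_E)
      then show "{w e, u} \<in> E'"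
        using edges[OF l(1), of x y] e(2) by (auto simp: insert_commute)
    qed
    show "E' \<inter> E = E - F"
      using cross multi E by simp
  qed (use graph FE inj wV V'_eq E in \<open>simp_all add: simple_graph_def\<close>)
  \<comment> \<open>Independence puts adjacent new nodes in different \<open>W k\<close>, so their
    edges lie in disjoint parts.\<close>
  have indep: "e \<inter> f = {}" if ef: "e \<in> F" "f \<in> F" "{w e, w f} \<in> E'" for e f
  proof -
    obtain k l where kl: "k \<in> {1..m}" "l \<in> {1..m}" "e \<in> nsets (P k) 2" "f \<in> nsets (P l) 2"
      using ef(1,2) unfolding F by blast
    have "{w e, w f} \<in> nsets V' 2"
      using ef(3) graph unfolding simple_graph_def by blast
    then have "w e \<noteq> w f"
      by (metis doubleton_in_nsets_2)
    then have "k \<noteq> l"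
      using ind[OF kl(1)] ef(3) kl W[OF kl(1)] by (auto simp: indep_def)
    then show ?thesis
      using P_disj[OF kl(1,2)] kl(3,4) by (auto simp: nsets_def)
  qed
  show ?thesis
    using gte facet_inducing_triangular_elimination[OF _ gte[unfolded E] indep] cardV n5
    unfolding E by auto
qed

end
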